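(* Let $\mathbb F\in\{\mathbb R,\mathbb C\}$, let $X$ be a separable Banach space over $\mathbb F$, and let $L$ be an extremally disconnected compact Hausdorff space. Then the pair $(X, C(L))$ has the Bishop--Phelps--Bollobás property.
   Context: $C(L)=C(L,\mathbb F)$ is the Banach space of continuous $\mathbb F$-valued functions on $L$ with the supremum norm. A compact Hausdorff space is extremally disconnected if the closure of every open subset is open. For a Banach space $Z$, $S_Z$ is its unit sphere; $\mathcal L(X,Y)$ is the space of bounded linear operators from $X$ to $Y$ with the operator norm. A pair of Banach spaces $(X,Y)$ over $\mathbb F$ has the Bishop--Phelps--Bollobás property (BPBp) if for every $\varepsilon\in(0,1)$ there exists $\eta(\varepsilon)>0$ such that whenever $T\in S_{\mathcal L(X,Y)}$ and $x_0\in S_X$ satisfy $\|Tx_0\|>1-\eta(\varepsilon)$, there exist $S\in S_{\mathcal L(X,Y)}$ and $u_0\in S_X$ such that $\|Su_0\|=1$, $\|u_0-x_0\|<\varepsilon$ and $\|S-T\|<\varepsilon$. *)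

theory Defs
  imports "HOL-Analysis.Analysis"
begin

text \<open>
  Isabelle's normed spaces carry only real scalars. A normed space over a field
  \<open>'f\<close> (here real or complex) is a type of class \<open>real_normed_vector\<close> together with a scalar
  multiplication by \<open>'f\<close> that extends the real one and is compatible with the given norm.
  Completeness does not depend on the scalars, so a Banach space over \<open>'f\<close> is such a
  structure on a type of class \<open>banach\<close>.
\<close>

locale normed_space_over = vector_space scale
  for scale :: "'f::real_normed_field \<Rightarrow> 'a::real_normed_vector \<Rightarrow> 'a" +
  assumes scale_of_real: "scale (of_real r) x = r *\<^sub>R x"
    and norm_scale: "norm (scale c x) = norm c * norm x"

lemma normed_space_over_scaleR:
  "normed_space_over (scaleR :: real \<Rightarrow> 'a::real_normed_vector \<Rightarrow> 'a)"
  by unfold_locales (auto simp: algebra_simps)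

text \<open>
  The type \<open>'l \<Rightarrow>\<^sub>C 'f\<close> consists of the bounded continuous functions with the supremum norm;
  for compact \<open>'l\<close> these are all continuous functions.
\<close>

lemma bcontfun_compact_eq:
  assumes "compact_space (euclidean :: 'l::topological_space topology)"
  shows "(bcontfun :: ('l \<Rightarrow> 'f::metric_space) set) = {f. continuous_on UNIV f}"
  using assms
  by (auto simp: bcontfun_def compact_space_def intro!: compact_imp_bounded compact_continuous_image)

definition scale_bcontfun ::
  "'f::real_normed_field \<Rightarrow> ('l::topological_space \<Rightarrow>\<^sub>C 'f) \<Rightarrow> 'l \<Rightarrow>\<^sub>C 'f" where
  "scale_bcontfun c f = Bcontfun (\<lambda>t. c * apply_bcontfun f t)"

lemma apply_scale_bcontfun [simp]:
  "apply_bcontfun (scale_bcontfun c f) t = c * apply_bcontfun f t"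
proof -
  have "bounded ((\<lambda>y. c * y) ` range (apply_bcontfun f))"
    by (rule bounded_linear_image[OF bounded_apply_bcontfun bounded_linear_mult_right])
  then have "(\<lambda>t. c * apply_bcontfun f t) \<in> bcontfun"
    by (auto simp: bcontfun_def image_image intro!: continuous_intros)
  then show ?thesis
    by (simp add: scale_bcontfun_def Bcontfun_inverse)
qed

definition extremally_disconnected :: "'a topology \<Rightarrow> bool" where
  "extremally_disconnected X \<longleftrightarrow> (\<forall>U. openin X U \<longrightarrow> openin X (X closure_of U))"

text \<open>
  \<open>'a \<Rightarrow>\<^sub>L 'b\<close> is the type of bounded real-linear operators with the operator norm. The bounded
  \<open>'f\<close>-linear operators are a subset of it, with the same norm.
\<close>

definition bounded_operators ::
  "('f::real_normed_field \<Rightarrow> 'a::real_normed_vector \<Rightarrow> 'a) \<Rightarrow>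
   ('f \<Rightarrow> 'b::real_normed_vector \<Rightarrow> 'b) \<Rightarrow> ('a \<Rightarrow>\<^sub>L 'b) set" where
  "bounded_operators sX sY = {T. Vector_Spaces.linear sX sY (blinfun_apply T)}"

definition BPBp ::
  "('f::real_normed_field \<Rightarrow> 'a::real_normed_vector \<Rightarrow> 'a) \<Rightarrow>
   ('f \<Rightarrow> 'b::real_normed_vector \<Rightarrow> 'b) \<Rightarrow> bool" where
  "BPBp sX sY \<longleftrightarrow>
     (\<forall>\<epsilon>::real. 0 < \<epsilon> \<and> \<epsilon> < 1 \<longrightarrow>
       (\<exists>\<eta>::real. \<eta> > 0 \<and>
         (\<forall>T \<in> bounded_operators sX sY. \<forall>x0.
            norm T = 1 \<and> norm x0 = 1 \<and> norm (blinfun_apply T x0) > 1 - \<eta> \<longrightarrow>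
            (\<exists>S \<in> bounded_operators sX sY. \<exists>u0.
               norm S = 1 \<and> norm u0 = 1 \<and> norm (blinfun_apply S u0) = 1 \<and>
               norm (u0 - x0) < \<epsilon> \<and> norm (S - T) < \<epsilon>))))"

lemma normed_space_over_scale_bcontfun:
  "normed_space_over
     (scale_bcontfun :: 'f::real_normed_field \<Rightarrow> ('l::topological_space \<Rightarrow>\<^sub>C 'f) \<Rightarrow> _)"
proof
  fix a b :: 'f and f g :: "'l \<Rightarrow>\<^sub>C 'f" and r :: real
  show "scale_bcontfun a (f + g) = scale_bcontfun a f + scale_bcontfun a g"
    by (rule bcontfun_eqI) (simp add: algebra_simps)
  show "scale_bcontfun (a + b) f = scale_bcontfun a f + scale_bcontfun b f"
    by (rule bcontfun_eqI) (simp add: algebra_simps)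
  show "scale_bcontfun a (scale_bcontfun b f) = scale_bcontfun (a * b) f"
    by (rule bcontfun_eqI) (simp add: algebra_simps)
  show "scale_bcontfun 1 f = f"
    by (rule bcontfun_eqI) simp
  show "scale_bcontfun (of_real r) f = r *\<^sub>R f"
    by (rule bcontfun_eqI) (simp add: scaleR_conv_of_real)
  have le: "norm (scale_bcontfun c h) \<le> norm c * norm h" for c :: 'f and h :: "'l \<Rightarrow>\<^sub>C 'f"
    by (rule norm_bound)
      (simp add: norm_mult mult_left_mono norm_bounded)
  show "norm (scale_bcontfun a f) = norm a * norm f"
  proof (cases "a = 0")
    case True
    with le[of a f] show ?thesis by simp
  next
    case False
    have "scale_bcontfun (inverse a) (scale_bcontfun a f) = f"
      using False by (intro bcontfun_eqI) simp
    with le[of "inverse a" "scale_bcontfun a f"]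
    have "norm f \<le> norm (scale_bcontfun a f) / norm a"
      by (simp add: norm_inverse divide_inverse mult.commute)
    then have "norm a * norm f \<le> norm (scale_bcontfun a f)"
      using False by (simp add: field_simps)
    with le[of a f] show ?thesis by simp
  qed
qed

end

theory Submission
  imports Defs
begin

text \<open>
  Consider real scalars first. An operator \<open>S\<close> satisfies \<open>\<parallel>S\<parallel> \<le> 1\<close> and \<open>\<parallel>S - T\<parallel> \<le> e\<close> as soon
  as \<open>S x t\<close> lies below \<open>q x t = inf z. \<parallel>x - z\<parallel> + T z t + e * \<parallel>z\<parallel>\<close>. Let \<open>P x\<close> be the greatest
  continuous minorant of \<open>q x\<close>. As \<open>L\<close> is extremally disconnected, \<open>C(L)\<close> is Dedekind complete, so the
  Hahn--Banach argument works for the sublinear map \<open>P\<close> and gives a linear \<open>S \<le> P\<close> with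
  \<open>S u = P u\<close> for a prescribed \<open>u\<close>. It remains to find \<open>u\<close> near \<open>x0\<close> and \<open>t0\<close> with \<open>P u t0 = 1\<close>.
  By Baire's theorem and the separability of \<open>X\<close>, some \<open>t0\<close> in the open set where \<open>T x0\<close> is close to
  \<open>1\<close> satisfies \<open>P x t0 = q x t0\<close> for all \<open>x\<close> simultaneously, and Ekeland's principle for
  \<open>\<parallel>x\<parallel> - T x t0\<close> yields \<open>u\<close> with \<open>q u t0 = 1\<close>. Complex operators are recovered from their real parts.
\<close>

section \<open>Ekeland's variational principle\<close>

text \<open>A greedy descent through the sets \<open>A x\<close> forms a Cauchy sequence, since
  \<open>e * dist\<close> between two terms is at most the drop of \<open>\<phi>\<close>.
  Completeness supplies the limit \<open>v\<close>, from which no further descent is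
  possible.\<close>

lemma ekeland_variational_principle:
  fixes \<phi> :: "'a::complete_space \<Rightarrow> real"
  assumes cont: "continuous_on UNIV \<phi>" and lb: "\<And>x. m \<le> \<phi> x" and e: "e > 0"
  obtains v where "\<phi> v + e * dist v x0 \<le> \<phi> x0" "\<And>w. \<phi> v \<le> \<phi> w + e * dist w v"
proof -
  \<comment> \<open>The lower section of \<open>x\<close> in Ekeland's order; \<open>Atrans\<close>
    is the transitivity of this order.\<close>
  define A where "A x = {w. \<phi> w + e * dist w x \<le> \<phi> x}" for x
  have Aself: "x \<in> A x" for x by (simp add: A_def)
  have Atrans: "z \<in> A x" if "z \<in> A y" "y \<in> A x" for x y z
  proof -
    have "e * dist z x \<le> e * (dist z y + dist y x)"
      using e by (intro mult_left_mono dist_triangle) auto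
    with that show ?thesis by (simp add: A_def algebra_simps)
  qed
  have bdd: "bdd_below (\<phi> ` A x)" for x using lb by (auto intro: bdd_belowI[of _ m])
  \<comment> \<open>Near-minimisers with error tending to \<open>0\<close>: any \<open>w\<close>
    that lies below the limit also lies below every term, so the limit value of
    \<open>\<phi>\<close> cannot exceed \<open>\<phi> w\<close>.\<close>
  have "\<exists>y. y \<in> A x \<and> (\<forall>w\<in>A x. \<phi> y \<le> \<phi> w + (1/2)^n)" for x n
  proof -
    have "Inf (\<phi> ` A x) < Inf (\<phi> ` A x) + (1/2)^n" by simp
    then obtain y where y: "y \<in> A x" "\<phi> y < Inf (\<phi> ` A x) + (1/2)^n"
      using Aself by (subst (asm) cInf_less_iff[OF _ bdd]) auto
    have "Inf (\<phi> ` A x) \<le> \<phi> w" if "w \<in> A x" for w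
      using that by (intro cInf_lower bdd) auto
    with y show ?thesis by (intro exI[of _ y]) force
  qed
  then obtain N where N: "\<And>x n. N x n \<in> A x" "\<And>x n w. w \<in> A x \<Longrightarrow> \<phi> (N x n) \<le> \<phi> w + (1/2)^n"
    by metis
  define X where "X = rec_nat x0 (\<lambda>n x. N x n)"
  have X0: "X 0 = x0" and XS: "X (Suc n) = N (X n) n" for n by (simp_all add: X_def)
  have XA: "X n \<in> A (X k)" if "k \<le> n" for k n
    using that by (induction n rule: dec_induct) (auto simp: XS Aself intro: Atrans N)
  have dec: "decseq (\<lambda>n. \<phi> (X n))"
  proof (rule decseq_SucI)
    fix n show "\<phi> (X (Suc n)) \<le> \<phi> (X n)"
      using XA[of n "Suc n"] e by (simp add: A_def) (smt (verit) mult_nonneg_nonneg zero_le_dist)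
  qed
  then have "convergent (\<lambda>n. \<phi> (X n))"
    using lb decseq_convergent[of "\<lambda>n. \<phi> (X n)" m] by (metis convergentI)
  then have CX: "Cauchy (\<lambda>n. \<phi> (X n))" by (rule convergent_Cauchy)
  have "Cauchy X"
  proof (rule metric_CauchyI)
    fix r :: real assume "r > 0"
    then obtain M where M: "\<And>k n. M \<le> k \<Longrightarrow> M \<le> n \<Longrightarrow> dist (\<phi> (X k)) (\<phi> (X n)) < e * r"
      using metric_CauchyD[OF CX, of "e * r"] e by auto
    have *: "dist (X n) (X k) < r" if "M \<le> k" "k \<le> n" for k n
    proof -
      have "e * dist (X n) (X k) \<le> \<phi> (X k) - \<phi> (X n)"
        using XA[OF that(2)] by (simp add: A_def)
      also have "\<dots> < e * r" using M[of k n] that by (simp add: dist_real_def)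
      finally show ?thesis using e by simp
    qed
    show "\<exists>M. \<forall>k\<ge>M. \<forall>n\<ge>M. dist (X k) (X n) < r"
    proof (intro exI allI impI)
      fix k n assume "M \<le> k" "M \<le> n"
      then show "dist (X k) (X n) < r"
        using *[of k n] *[of n k] by (cases "k \<le> n") (auto simp: dist_commute)
    qed
  qed
  then obtain v where v: "X \<longlonglongrightarrow> v" using Cauchy_convergent convergentD by blast
  have phiv: "(\<lambda>n. \<phi> (X n)) \<longlonglongrightarrow> \<phi> v"
    using cont v continuous_on_tendsto_compose[OF cont v] by simp
  have vA: "v \<in> A (X k)" for k
  proof -
    have "(\<lambda>n. \<phi> (X n) + e * dist (X n) (X k)) \<longlonglongrightarrow> \<phi> v + e * dist v (X k)"
      by (intro tendsto_intros phiv v)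
    moreover have "\<forall>n\<ge>k. \<phi> (X n) + e * dist (X n) (X k) \<le> \<phi> (X k)"
      using XA by (auto simp: A_def)
    ultimately show ?thesis unfolding A_def by (auto intro: LIMSEQ_le_const2)
  qed
  show thesis
  proof
    show "\<phi> v + e * dist v x0 \<le> \<phi> x0" using vA[of 0] by (simp add: A_def X0)
    fix w
    show "\<phi> v \<le> \<phi> w + e * dist w v"
    proof (rule ccontr)
      assume less: "\<not> ?thesis"
      then have "w \<in> A v" by (simp add: A_def)
      then have "\<phi> (X (Suc n)) \<le> \<phi> w + (1/2)^n" for n
        using N(2)[of w "X n" n] Atrans vA by (simp add: XS)
      moreover have "(\<lambda>n. \<phi> (X (Suc n))) \<longlonglongrightarrow> \<phi> v" using phiv by (rule LIMSEQ_Suc)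
      moreover have "(\<lambda>n. \<phi> w + (1/2)^n) \<longlonglongrightarrow> \<phi> w + 0"
        by (intro tendsto_intros LIMSEQ_power_zero) auto
      ultimately have "\<phi> v \<le> \<phi> w" by (metis (no_types, lifting) LIMSEQ_le add.right_neutral)
      moreover have "0 \<le> e * dist w v" using e by simp
      ultimately show False using less by linarith
    qed
  qed
qed

text \<open>Ekeland's principle for \<open>norm x - f x\<close> gives a point \<open>v\<close> near
  \<open>x0\<close>. The last inequality holds for \<open>v\<close> with \<open>norm v\<close> in
  place of \<open>1\<close>, and homogeneity carries it over to the normalised vector. Normalising
  at most doubles the distance to \<open>x0\<close>, whence the factor 2.\<close>

lemma norm_support_functional_perturbation:
  fixes f :: "'x::banach \<Rightarrow> real"
  assumes lin: "linear f" and le: "\<And>x. f x \<le> norm x"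
    and x0: "norm x0 = 1" "f x0 > 1 - \<eta>" and e: "e > 0" and \<eta>: "\<eta> < e"
  obtains u where "norm u = 1" "norm (u - x0) \<le> 2 * \<eta> / e"
    "\<And>z. 1 \<le> norm (u - z) + f z + e * norm z"
proof -
  interpret linear f by fact
  have "bounded_linear f"
    using le[of x for x] le[of "- x" for x]
    by (intro bounded_linear_intro[of f 1]) (auto simp: add scale neg abs_le_iff)
  then have cont: "continuous_on UNIV (\<lambda>x. norm x - f x)"
    by (intro continuous_intros linear_continuous_on)
  have "0 \<le> norm x - f x" for x using le by (simp add: algebra_simps)
  from ekeland_variational_principle[OF cont this e, of x0] obtain v where
    v: "norm v - f v + e * dist v x0 \<le> norm x0 - f x0"
      "\<And>w. norm v - f v \<le> norm w - f w + e * dist w v" by blast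
  have ed: "e * dist v x0 < \<eta>" using v(1) le[of v] x0 by linarith
  then have "e * dist v x0 < e * 1" using \<eta> by linarith
  \<comment> \<open>As \<open>norm x0 = 1\<close>, this keeps \<open>v\<close> away from
    \<open>0\<close>, so that \<open>v\<close> can be normalised.\<close>
  then have d1: "dist v x0 < 1" using e by simp
  have d: "dist v x0 \<le> \<eta> / e" using ed e by (simp add: field_simps)
  have nv: "\<bar>norm v - 1\<bar> \<le> dist v x0"
    using norm_triangle_ineq3[of v x0] x0 by (simp add: dist_norm)
  then have v0: "norm v > 0" using d1 by linarith
  define u where "u = v /\<^sub>R norm v"
  show thesis
  proof
    show "norm u = 1" using v0 by (simp add: u_def)
    have "u - v = (1 / norm v - 1) *\<^sub>R v"
      by (simp add: u_def scaleR_diff_left divide_inverse)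
    then have "norm (u - v) = \<bar>1 / norm v - 1\<bar> * norm v" by simp
    also have "\<dots> = \<bar>(1 / norm v - 1) * norm v\<bar>" using v0 by (simp add: abs_mult)
    also have "(1 / norm v - 1) * norm v = 1 - norm v" using v0 by (simp add: left_diff_distrib)
    finally have "norm (u - v) \<le> dist v x0" using nv by linarith
    then have "norm (u - x0) \<le> 2 * dist v x0"
      using norm_triangle_ineq[of "u - v" "v - x0"] by (simp add: dist_norm)
    then show "norm (u - x0) \<le> 2 * \<eta> / e" using d by simp
    fix z :: 'x
    \<comment> \<open>The competitor \<open>v - y\<close> in Ekeland's inequality is
      \<open>norm v\<close> times \<open>u - z\<close>.\<close>
    define y where "y = norm v *\<^sub>R z"
    have "norm v \<le> norm (v - y) + f y + e * norm y"
      using v(2)[of "v - y"] by (simp add: diff dist_norm)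
    moreover have "v - y = norm v *\<^sub>R (u - z)" using v0 by (simp add: u_def y_def scaleR_right_diff_distrib)
    then have "norm (v - y) = norm v * norm (u - z)" by simp
    ultimately have "norm v * 1 \<le> norm v * (norm (u - z) + f z + e * norm z)"
      by (simp add: y_def scale distrib_left ac_simps)
    then show "1 \<le> norm (u - z) + f z + e * norm z" using v0 by (simp only: mult_le_cancel_left_pos)
  qed
qed

section \<open>Infima in the lattice of continuous functions\<close>

text \<open>
  In an extremally disconnected space this is the greatest continuous minorant of \<open>F\<close>; the
  pointwise infimum would be the same formula without the closure.
\<close>

definition cont_inf :: "('l::topological_space \<Rightarrow> real) set \<Rightarrow> 'l \<Rightarrow> real" where
  "cont_inf F t = Inf {c. t \<in> closure (\<Union>f\<in>F. {s. f s < c})}"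

context
  fixes F :: "('l::topological_space \<Rightarrow> real) set" and m :: real
  assumes ne: "F \<noteq> {}" and cont: "\<And>f. f \<in> F \<Longrightarrow> continuous_on UNIV f"
    and lb: "\<And>f t. f \<in> F \<Longrightarrow> m \<le> f t"
begin

text \<open>By \<open>ne\<close> and \<open>lb\<close> the set under \<open>Inf\<close> is nonempty
  and bounded below, so the infimum is a genuine one. This exhibits a strict sublevel set as a union
  of closures of open sets.\<close>

lemma cont_inf_less_iff:
  "cont_inf F t < c \<longleftrightarrow> (\<exists>c'<c. t \<in> closure (\<Union>f\<in>F. {s. f s < c'}))"
proof -
  obtain f where f: "f \<in> F" using ne by blast
  have "f t < f t + 1" by simp
  then have "t \<in> (\<Union>g\<in>F. {s. g s < f t + 1})" using f by blast
  then have "t \<in> closure (\<Union>g\<in>F. {s. g s < f t + 1})" by (rule subsetD[OF closure_subset])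
  then have "f t + 1 \<in> {c. t \<in> closure (\<Union>f\<in>F. {s. f s < c})}" by (rule CollectI)
  then have 1: "{c. t \<in> closure (\<Union>f\<in>F. {s. f s < c})} \<noteq> {}" by (metis empty_iff)
  have "m \<le> c" if "t \<in> closure (\<Union>f\<in>F. {s. f s < c})" for c
  proof (rule ccontr)
    assume "\<not> m \<le> c"
    then have "\<not> f s < c" if "f \<in> F" for f s using lb[OF that, of s] by simp
    then have "(\<Union>f\<in>F. {s. f s < c}) = {}" by simp
    with that show False by simp
  qed
  then have 2: "bdd_below {c. t \<in> closure (\<Union>f\<in>F. {s. f s < c})}"
    by (auto intro: bdd_belowI[of _ m])
  show ?thesis unfolding cont_inf_def cInf_less_iff[OF 1 2] by auto
qed

lemma open_sublevel: "open (\<Union>f\<in>F. {s. f s < c})"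
  by (intro open_UN ballI open_Collect_less cont continuous_intros)

lemma cont_inf_lower:
  assumes "f \<in> F" shows "cont_inf F t \<le> f t"
proof (rule ccontr)
  assume "\<not> ?thesis"
  then obtain x where x: "f t < x" "x < cont_inf F t" using dense[of "f t"] by (auto simp: not_le)
  have "t \<in> (\<Union>g\<in>F. {s. g s < x})" using assms x(1) by blast
  then have "t \<in> closure (\<Union>g\<in>F. {s. g s < x})" by (rule subsetD[OF closure_subset])
  then have "cont_inf F t < cont_inf F t" using x(2) by (subst cont_inf_less_iff) blast
  then show False by simp
qed

text \<open>The set where \<open>k s \<le> c\<close> is closed, so it contains the closure of each
  set that it contains.\<close>

lemma cont_inf_greatest:
  assumes k: "continuous_on UNIV k" and le: "\<And>f s. f \<in> F \<Longrightarrow> k s \<le> f s"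
  shows "k t \<le> cont_inf F t"
proof (rule ccontr)
  assume "\<not> ?thesis"
  then obtain c where c: "c < k t" "t \<in> closure (\<Union>f\<in>F. {s. f s < c})"
    using cont_inf_less_iff by (auto simp: not_le)
  have "(\<Union>f\<in>F. {s. f s < c}) \<subseteq> {s. k s \<le> c}"
  proof clarify
    fix f s assume "f \<in> F" "f s < c"
    then show "k s \<le> c" using le[of f s] by simp
  qed
  moreover have "closed {s. k s \<le> c}"
    by (intro closed_Collect_le k continuous_intros)
  ultimately have "t \<in> {s. k s \<le> c}" using c(2) closure_minimal by blast
  then show False using c(1) by simp
qed

text \<open>Weak sublevel sets are intersections of closures, hence closed in any space. Strict ones
  are unions of closures of open sets, and these are open by extremal disconnectedness.\<close>

lemma continuous_on_cont_inf:
  assumes ed: "extremally_disconnected (euclidean :: 'l topology)"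
  shows "continuous_on UNIV (cont_inf F)"
proof (rule continuous_on_generate_topology[OF open_generated_order])
  have "{t. cont_inf F t < c} = (\<Union>c'\<in>{..<c}. closure (\<Union>f\<in>F. {s. f s < c'}))" for c
    using cont_inf_less_iff by auto
  then have up: "open {t. cont_inf F t < c}" for c
    using ed by (auto intro!: open_UN open_sublevel simp: extremally_disconnected_def)
  have mono: "closure (\<Union>f\<in>F. {s. f s < c}) \<subseteq> closure (\<Union>f\<in>F. {s. f s < c'})" if "c \<le> c'" for c c'
    using that by (intro closure_mono) force
  have "{t. cont_inf F t \<le> c} = (\<Inter>c'\<in>{c<..}. closure (\<Union>f\<in>F. {s. f s < c'}))" for c
  proof (intro equalityI subsetI)
    fix t assume "t \<in> {t. cont_inf F t \<le> c}"
    then have "\<exists>d<c'. t \<in> closure (\<Union>f\<in>F. {s. f s < d})" if "c < c'" for c'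
      using that cont_inf_less_iff[of t c'] by auto
    then show "t \<in> (\<Inter>c'\<in>{c<..}. closure (\<Union>f\<in>F. {s. f s < c'}))"
      using mono[OF less_imp_le] by blast
  next
    fix t assume t: "t \<in> (\<Inter>c'\<in>{c<..}. closure (\<Union>f\<in>F. {s. f s < c'}))"
    have "cont_inf F t \<le> d" if cd: "c < d" for d
    proof -
      obtain c' where "c < c'" "c' < d" using dense[OF cd] by blast
      with t show ?thesis using cont_inf_less_iff[of t d] by (blast intro: less_imp_le)
    qed
    then have "cont_inf F t \<le> c" by (rule dense_ge)
    then show "t \<in> {t. cont_inf F t \<le> c}" by simp
  qed
  then have "closed {t. cont_inf F t \<le> c}" for c by auto
  then have lo: "open {t. c < cont_inf F t}" for c
    using open_Compl[of "{t. cont_inf F t \<le> c}"] by (simp add: Compl_eq Collect_neg_eq[symmetric] not_le)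
  fix B :: "real set" assume "B \<in> range lessThan \<union> range greaterThan"
  then obtain c where "B = {..<c} \<or> B = {c<..}" by auto
  then have "open (cont_inf F -` B)"
    using up[of c] lo[of c] by (auto simp: vimage_def)
  then show "\<exists>C. open C \<and> C \<inter> UNIV = cont_inf F -` B \<inter> UNIV" by auto
qed

text \<open>Where taking closures adds nothing, \<open>cont_inf\<close> is the pointwise infimum.
  Rational levels suffice by density, which leaves only countably many conditions on
  \<open>t\<close> for a Baire argument.\<close>

lemma cont_inf_greatest_pointwise:
  assumes "\<And>c. c \<in> \<rat> \<Longrightarrow> t \<in> closure (\<Union>f\<in>F. {s. f s < c}) \<Longrightarrow> t \<in> (\<Union>f\<in>F. {s. f s < c})"
    and "\<And>f. f \<in> F \<Longrightarrow> a \<le> f t"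
  shows "a \<le> cont_inf F t"
proof (rule ccontr)
  assume "\<not> ?thesis"
  then obtain c where c: "c \<in> \<rat>" "cont_inf F t < c" "c < a"
    using Rats_dense_in_real[of "cont_inf F t" a] by auto
  then obtain c' where c': "c' < c" "t \<in> closure (\<Union>f\<in>F. {s. f s < c'})"
    using cont_inf_less_iff by blast
  have "(\<Union>f\<in>F. {s. f s < c'}) \<subseteq> (\<Union>f\<in>F. {s. f s < c})"
    using c'(1) by (auto intro: less_trans)
  then have "t \<in> closure (\<Union>f\<in>F. {s. f s < c})" using c'(2) closure_mono by blast
  from assms(1)[OF c(1) this] assms(2) c(3) show False by force
qed

end

section \<open>A Hahn--Banach extension with values in a function lattice\<close>

text \<open>Homogeneity is stated as an inequality for positive factors because that is what passes
  easily to infima; \<open>sublinear_map_scale\<close> recovers equality. The norm bound also yields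
  the lower bound \<open>- norm x\<close> and a Lipschitz estimate.\<close>

definition sublinear_map :: "('x::real_normed_vector \<Rightarrow> 'l::topological_space \<Rightarrow> real) \<Rightarrow> bool" where
  "sublinear_map P \<longleftrightarrow>
     (\<forall>x. continuous_on UNIV (P x)) \<and>
     (\<forall>x y t. P (x + y) t \<le> P x t + P y t) \<and>
     (\<forall>x t c. 0 < c \<longrightarrow> P (c *\<^sub>R x) t \<le> c * P x t) \<and>
     (\<forall>x t. P x t \<le> norm x)"

context
  fixes P :: "'x::real_normed_vector \<Rightarrow> 'l::topological_space \<Rightarrow> real"
  assumes P: "sublinear_map P"
begin

lemma sublinear_map_cont: "continuous_on UNIV (P x)"
  and sublinear_map_add: "P (x + y) t \<le> P x t + P y t"
  and sublinear_map_norm: "P x t \<le> norm x"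
  using P by (auto simp: sublinear_map_def)

lemma sublinear_map_zero: "P 0 t = 0"
proof -
  have "P (2 *\<^sub>R 0) t \<le> 2 * P 0 t" "P ((1/2) *\<^sub>R 0) t \<le> (1/2) * P 0 t"
    using P unfolding sublinear_map_def by (blast intro: zero_less_numeral zero_less_divide_1_iff[THEN iffD2])+
  then show ?thesis by simp
qed

lemma sublinear_map_scale:
  assumes "0 \<le> c" shows "P (c *\<^sub>R x) t = c * P x t"
proof (cases "c = 0")
  case True
  then show ?thesis by (simp add: sublinear_map_zero)
next
  case False
  then have c: "0 < c" using assms by simp
  have "P (inverse c *\<^sub>R (c *\<^sub>R x)) t \<le> inverse c * P (c *\<^sub>R x) t"
    using P c unfolding sublinear_map_def by (meson positive_imp_inverse_positive)
  then have "c * P x t \<le> P (c *\<^sub>R x) t" using c by (simp add: field_simps)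
  moreover have "P (c *\<^sub>R x) t \<le> c * P x t" using P c by (simp add: sublinear_map_def)
  ultimately show ?thesis by simp
qed

lemma sublinear_map_neg: "- P (- x) t \<le> P x t"
  using sublinear_map_add[of x "- x" t] sublinear_map_zero by simp

lemma sublinear_map_lower: "- norm x \<le> P x t"
  using sublinear_map_neg[of x t] sublinear_map_norm[of "- x" t] by simp

lemma sublinear_map_diff: "P x t \<le> P y t + norm (x - y)"
  using sublinear_map_add[of y "x - y" t] sublinear_map_norm[of "x - y" t] by simp

end

text \<open>As \<open>cont_inf\<close> is not a pointwise infimum, estimates for members of the
  families pass to it only through its being the greatest continuous minorant. For additivity this
  is applied to one family at a time.\<close>

lemma sublinear_map_cont_inf:
  fixes F :: "'x::real_normed_vector \<Rightarrow> ('l::topological_space \<Rightarrow> real) set"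
  assumes ed: "extremally_disconnected (euclidean :: 'l topology)"
    and cont: "\<And>x f. f \<in> F x \<Longrightarrow> continuous_on UNIV f"
    and lb: "\<And>x f t. f \<in> F x \<Longrightarrow> - norm x \<le> f t"
    and add: "\<And>x y f g. f \<in> F x \<Longrightarrow> g \<in> F y \<Longrightarrow> \<exists>h\<in>F (x + y). \<forall>t. h t \<le> f t + g t"
    and hom: "\<And>x f c. f \<in> F x \<Longrightarrow> 0 < c \<Longrightarrow> \<exists>h\<in>F (c *\<^sub>R x). \<forall>t. h t \<le> c * f t"
    and ub: "\<And>x. \<exists>f\<in>F x. \<forall>t. f t \<le> norm x"
  shows "sublinear_map (\<lambda>x. cont_inf (F x))"
proof -
  have ne: "F x \<noteq> {}" for x using ub[of x] by blast
  have lower: "cont_inf (F x) t \<le> f t" if "f \<in> F x" for x f t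
    by (rule cont_inf_lower[where F = "F x" and m = "- norm x"]) (erule lb cont | rule ne that)+
  have greatest: "k t \<le> cont_inf (F x) t"
    if "continuous_on UNIV k" "\<And>f s. f \<in> F x \<Longrightarrow> k s \<le> f s" for k x t
    by (rule cont_inf_greatest[where F = "F x" and m = "- norm x"])
      (erule lb cont that(2) | rule ne that(1))+
  have C: "continuous_on UNIV (cont_inf (F x))" for x
    by (rule continuous_on_cont_inf[where F = "F x" and m = "- norm x"])
      (erule lb cont | rule ne ed)+
  show ?thesis unfolding sublinear_map_def
  proof (intro conjI allI impI C)
    fix x t
    show "cont_inf (F x) t \<le> norm x" using ub[of x] lower by (meson order_trans)
  next
    fix x y t
    let ?k = "cont_inf (F (x + y))"
    have 1: "?k s \<le> f s + g s" if "f \<in> F x" "g \<in> F y" for f g s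
      using add[OF that] lower by (meson order_trans)
    \<comment> \<open>With \<open>g\<close> fixed, the left side is a continuous minorant of all of
      \<open>F x\<close>; afterwards \<open>cont_inf (F x)\<close> is moved to the left in the same
      way.\<close>
    have 2: "?k s - g s \<le> cont_inf (F x) s" if g: "g \<in> F y" for g s
      by (rule greatest[where k = "\<lambda>s. ?k s - g s"])
        (use 1[OF _ g] in \<open>auto intro!: continuous_on_diff C cont[OF g] simp: algebra_simps\<close>)
    have "?k t - cont_inf (F x) t \<le> cont_inf (F y) t"
      by (rule greatest[where k = "\<lambda>s. ?k s - cont_inf (F x) s"])
        (use 2 in \<open>auto intro!: continuous_on_diff C simp: algebra_simps\<close>)
    then show "?k t \<le> cont_inf (F x) t + cont_inf (F y) t" by simp
  next
    fix x t and c :: real assume c: "0 < c"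
    let ?k = "cont_inf (F (c *\<^sub>R x))"
    have 1: "?k s \<le> c * f s" if "f \<in> F x" for f s
      using hom[OF that c] lower by (meson order_trans)
    have "?k t / c \<le> cont_inf (F x) t"
    proof (rule greatest[where k = "\<lambda>s. ?k s / c"])
      show "continuous_on UNIV (\<lambda>s. ?k s / c)"
        using c by (intro continuous_on_divide C continuous_on_const) simp
      show "?k s / c \<le> f s" if "f \<in> F x" for f s
        using 1[OF that, of s] c by (simp add: pos_divide_le_eq mult.commute[of c])
    qed
    then show "?k t \<le> c * cont_inf (F x) t" using c by (simp add: pos_divide_le_eq mult.commute[of c])
  qed
qed

text \<open>The one-dimensional Hahn--Banach step: below \<open>linearize P d\<close>, every sublinear map is linear
  in the direction \<open>d\<close>.\<close>

definition linearize ::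
  "('x::real_normed_vector \<Rightarrow> 'l::topological_space \<Rightarrow> real) \<Rightarrow> 'x \<Rightarrow> 'x \<Rightarrow> 'l \<Rightarrow> real" where
  "linearize P d y = cont_inf ((\<lambda>s t. P (y + s *\<^sub>R d) t - s * P d t) ` {0..})"

context
  fixes P :: "'x::real_normed_vector \<Rightarrow> 'l::topological_space \<Rightarrow> real"
  assumes ed: "extremally_disconnected (euclidean :: 'l topology)" and P: "sublinear_map P"
begin

lemma linearize_bound:
  assumes "0 \<le> s" shows "- norm y \<le> P (y + s *\<^sub>R d) t - s * P d t"
proof -
  have "P (y + s *\<^sub>R d + - y) t \<le> P (y + s *\<^sub>R d) t + P (- y) t"
    by (rule sublinear_map_add[OF P])
  moreover have "y + s *\<^sub>R d + - y = s *\<^sub>R d" by simp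
  moreover have "P (- y) t \<le> norm y"
    using sublinear_map_norm[OF P, of "- y" t] by simp
  ultimately show ?thesis
    using sublinear_map_scale[OF P assms, of d t] by simp
qed

lemma linearize_family:
  assumes "f \<in> (\<lambda>s t. P (y + s *\<^sub>R d) t - s * P d t) ` {0..}"
  shows "continuous_on UNIV f" "- norm y \<le> f t"
proof -
  obtain s where s: "0 \<le> s" and f: "f = (\<lambda>t. P (y + s *\<^sub>R d) t - s * P d t)"
    using assms by (elim imageE) simp
  show "continuous_on UNIV f"
    unfolding f by (intro continuous_on_diff continuous_on_mult_left sublinear_map_cont[OF P])
  show "- norm y \<le> f t" unfolding f by (rule linearize_bound[OF s])
qed

lemma linearize_le:
  assumes "0 \<le> s" shows "linearize P d y t \<le> P (y + s *\<^sub>R d) t - s * P d t"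
  unfolding linearize_def
proof (rule cont_inf_lower[where m = "- norm y" and f = "\<lambda>t. P (y + s *\<^sub>R d) t - s * P d t"])
  show "(\<lambda>t. P (y + s *\<^sub>R d) t - s * P d t) \<in> (\<lambda>s t. P (y + s *\<^sub>R d) t - s * P d t) ` {0..}"
    using assms by (intro imageI) simp
qed (erule linearize_family | simp)+

text \<open>The parameters of the infimum follow the vectors: \<open>r + s\<close> serves a sum and
  \<open>c * r\<close> a multiple, while \<open>0\<close> gives the norm bound.\<close>

lemma sublinear_map_linearize: "sublinear_map (linearize P d)"
  unfolding linearize_def
proof (rule sublinear_map_cont_inf[OF ed])
  fix x y f g
  assume "f \<in> (\<lambda>s t. P (x + s *\<^sub>R d) t - s * P d t) ` {0..}"
    "g \<in> (\<lambda>s t. P (y + s *\<^sub>R d) t - s * P d t) ` {0..}"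
  then obtain r s where rs: "0 \<le> r" "0 \<le> s" and
    f: "f = (\<lambda>t. P (x + r *\<^sub>R d) t - r * P d t)" and g: "g = (\<lambda>t. P (y + s *\<^sub>R d) t - s * P d t)"
    by (elim imageE) simp
  have eq: "x + y + (r + s) *\<^sub>R d = (x + r *\<^sub>R d) + (y + s *\<^sub>R d)"
    by (simp add: scaleR_add_left)
  show "\<exists>h\<in>(\<lambda>s t. P (x + y + s *\<^sub>R d) t - s * P d t) ` {0..}. \<forall>t. h t \<le> f t + g t"
  proof (intro bexI[OF _ imageI] allI)
    show "P (x + y + (r + s) *\<^sub>R d) t - (r + s) * P d t \<le> f t + g t" for t
      using sublinear_map_add[OF P, of "x + r *\<^sub>R d" "y + s *\<^sub>R d" t]
      unfolding f g distrib_right eq by linarith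
    show "r + s \<in> {0..}" using rs by simp
  qed
next
  fix x f and c :: real
  assume "f \<in> (\<lambda>s t. P (x + s *\<^sub>R d) t - s * P d t) ` {0..}" and c: "0 < c"
  then obtain r where r: "0 \<le> r" and f: "f = (\<lambda>t. P (x + r *\<^sub>R d) t - r * P d t)"
    by (elim imageE) simp
  have eq: "c *\<^sub>R x + (c * r) *\<^sub>R d = c *\<^sub>R (x + r *\<^sub>R d)"
    by (simp add: scaleR_add_right)
  show "\<exists>h\<in>(\<lambda>s t. P (c *\<^sub>R x + s *\<^sub>R d) t - s * P d t) ` {0..}. \<forall>t. h t \<le> c * f t"
  proof (intro bexI[OF _ imageI] allI)
    show "P (c *\<^sub>R x + (c * r) *\<^sub>R d) t - (c * r) * P d t \<le> c * f t" for t
      using sublinear_map_scale[OF P, of c "x + r *\<^sub>R d" t] c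
      unfolding f eq right_diff_distrib by simp
    show "c * r \<in> {0..}" using r c by simp
  qed
next
  fix x
  show "\<exists>f\<in>(\<lambda>s t. P (x + s *\<^sub>R d) t - s * P d t) ` {0..}. \<forall>t. f t \<le> norm x"
  proof (intro bexI[OF _ imageI] allI)
    show "P (x + 0 *\<^sub>R d) t - 0 * P d t \<le> norm x" for t
      using sublinear_map_norm[OF P, of x t] by simp
    show "(0::real) \<in> {0..}" by simp
  qed
qed (erule linearize_family)+

end

text \<open>Separability replaces transfinite induction: \<open>P\<close> is linearized along a
  dense sequence of directions, and the infimum \<open>S\<close> of the resulting decreasing
  sequence is sublinear. It is odd on the dense sequence, hence everywhere, and an odd sublinear map
  is linear.\<close>

lemma linear_minorant_of_sublinear_map:
  fixes P :: "'x::real_normed_vector \<Rightarrow> 'l::topological_space \<Rightarrow> real"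
  assumes ed: "extremally_disconnected (euclidean :: 'l topology)" and P: "sublinear_map P"
    and sep: "separable_space (euclidean :: 'x topology)"
  obtains S where "\<And>x. continuous_on UNIV (S x)" "\<And>t. linear (\<lambda>x. S x t)"
    "\<And>x t. S x t \<le> P x t" "\<And>t. S u t = P u t"
proof -
  obtain D :: "'x set" where D: "countable D" "closure D = UNIV"
    using sep by (auto simp: separable_space_def)
  \<comment> \<open>The vector \<open>u\<close> comes first, so the first linearization is of
    \<open>P\<close> itself and preserves the value \<open>P u\<close>.\<close>
  define d where "d = case_nat u (from_nat_into D)"
  have d0: "d 0 = u" by (simp add: d_def)
  have "D \<subseteq> range d"
  proof
    fix x assume "x \<in> D"
    then obtain n where "from_nat_into D n = x" using from_nat_into_surj[OF D(1)] by blast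
    then have "d (Suc n) = x" by (simp add: d_def)
    then show "x \<in> range d" by blast
  qed
  then have dense: "closure (range d) = UNIV" using D closure_mono by blast
  define Q where "Q = rec_nat P (\<lambda>n R. linearize R (d n))"
  have Q0: "Q 0 = P" and QS: "Q (Suc n) = linearize (Q n) (d n)" for n by (simp_all add: Q_def)
  have Q: "sublinear_map (Q n)" for n
    by (induction n) (simp_all add: Q0 QS P sublinear_map_linearize[OF ed])
  have "Q (Suc n) x t \<le> Q n x t" for n x t
    using linearize_le[OF ed Q, of 0 n "d n" x t] by (simp add: QS)
  then have Qdec: "Q n x t \<le> Q k x t" if "k \<le> n" for k n x t
    using that by (rule lift_Suc_antimono_le[of "\<lambda>n. Q n x t"])
  define S where "S x = cont_inf (range (\<lambda>n. Q n x))" for x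
  have S_le: "S x t \<le> Q n x t" for x n t
    unfolding S_def
    by (rule cont_inf_lower[where m = "- norm x"]) (auto intro: sublinear_map_lower sublinear_map_cont Q)
  have S: "sublinear_map S"
    unfolding S_def
  proof (rule sublinear_map_cont_inf[OF ed])
    fix x y f g assume "f \<in> range (\<lambda>n. Q n x)" "g \<in> range (\<lambda>n. Q n y)"
    then obtain i j where f: "f = Q i x" and g: "g = Q j y" by auto
    have "Q (max i j) (x + y) t \<le> Q i x t + Q j y t" for t
      using sublinear_map_add[OF Q, of "max i j" x y t] Qdec[of i "max i j" x t] Qdec[of j "max i j" y t]
      by simp
    then show "\<exists>h\<in>range (\<lambda>n. Q n (x + y)). \<forall>t. h t \<le> f t + g t" by (auto simp: f g)
  next
    fix x show "\<exists>f\<in>range (\<lambda>n. Q n x). \<forall>t. f t \<le> norm x"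
      using sublinear_map_norm[OF Q] by blast
  qed (auto intro: sublinear_map_cont sublinear_map_lower Q simp: sublinear_map_scale Q)
  \<comment> \<open>In the infimum for \<open>- d n\<close> the parameter \<open>1\<close> gives the
    vector \<open>0\<close>.\<close>
  have Sneg_d: "S (- d n) t \<le> - Q n (d n) t" for n t
    using S_le[of "- d n" t "Suc n"] linearize_le[OF ed Q, of 1 n "d n" "- d n" t]
    by (simp add: QS sublinear_map_zero[OF Q])
  have Sd: "S (d n) t + S (- d n) t \<le> 0" for n t
    using Sneg_d[of n t] S_le[of "d n" t n] by simp
  \<comment> \<open>Both \<open>S x\<close> and \<open>S (- x)\<close> are 1-Lipschitz in
    \<open>x\<close>, so the inequality \<open>Sd\<close> extends by density.\<close>
  have Sneg: "S (- x) t = - S x t" for x t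
  proof -
    have "S x t + S (- x) t \<le> r" if "r > 0" for r
    proof -
      have "x \<in> closure (range d)" by (simp add: dense)
      then have "\<exists>y\<in>range d. dist y x < r / 2"
        using \<open>r > 0\<close> unfolding closure_approachable by (meson half_gt_zero)
      then obtain n where n: "dist (d n) x < r / 2" by blast
      have "S x t \<le> S (d n) t + norm (x - d n)" "S (- x) t \<le> S (- d n) t + norm (x - d n)"
        using sublinear_map_diff[OF S, of x t "d n"] sublinear_map_diff[OF S, of "- x" t "- d n"]
        by (simp_all add: norm_minus_commute)
      with n Sd[of n t] show ?thesis by (simp add: dist_norm norm_minus_commute)
    qed
    then have "S x t + S (- x) t \<le> 0" by (rule dense_ge)
    with sublinear_map_neg[OF S, of x t] show ?thesis by simp
  qed
  show thesis
  proof
    show "continuous_on UNIV (S x)" for x by (rule sublinear_map_cont[OF S])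
    show "S x t \<le> P x t" for x t using S_le[of x t 0] by (simp add: Q0)
    show "S u t = P u t" for t
      using Sneg_d[of 0 t] S_le[of u t 0] by (simp add: d0 Q0 Sneg)
    show "linear (\<lambda>x. S x t)" for t
    proof
      fix x y
      have "S (- x + - y) t \<le> S (- x) t + S (- y) t" by (rule sublinear_map_add[OF S])
      then have "- S (x + y) t \<le> - S x t - S y t"
        using Sneg[of "x + y" t] by (simp add: Sneg)
      then show "S (x + y) t = S x t + S y t"
        using sublinear_map_add[OF S, of x y t] by simp
    next
      fix c x
      show "S (c *\<^sub>R x) t = c *\<^sub>R S x t"
        using sublinear_map_scale[OF S, of c x t] sublinear_map_scale[OF S, of "- c" x t] Sneg[of "c *\<^sub>R x" t]
        by (cases "0 \<le> c") auto
    qed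
  qed
qed

section \<open>The real pointwise version\<close>

text \<open>For open \<open>W\<close> the set \<open>closure W - W\<close> is closed with empty
  interior, and compact Hausdorff spaces are Baire spaces, so countably many such sets cannot cover
  \<open>U\<close>.\<close>

lemma baire_generic_point:
  fixes \<W> :: "'l::t2_space set set"
  assumes comp: "compact_space (euclidean :: 'l topology)" and \<W>: "countable \<W>" "\<And>W. W \<in> \<W> \<Longrightarrow> open W"
    and U: "open U" "U \<noteq> {}"
  obtains t where "t \<in> U" "\<And>W. W \<in> \<W> \<Longrightarrow> t \<in> closure W \<Longrightarrow> t \<in> W"
proof -
  have "Hausdorff_space (euclidean :: 'l topology)"
    unfolding Hausdorff_space_def disjnt_def using hausdorff by auto
  then have reg: "locally_compact_space (euclidean :: 'l topology) \<and> regular_space (euclidean :: 'l topology)"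
    using comp compact_imp_locally_compact_space compact_Hausdorff_imp_regular_space by blast
  have int: "interior (closure W - W) = {}" for W :: "'l set"
  proof -
    have "interior (closure W - W) \<inter> W = {}" using interior_subset by fastforce
    then have "interior (closure W - W) \<inter> closure W = {}"
      by (simp add: open_Int_closure_eq_empty)
    then show ?thesis using interior_subset by fastforce
  qed
  have "euclidean interior_of \<Union>((\<lambda>W. closure W - W) ` \<W>) = {}"
    by (rule Baire_category_alt) (use reg \<W> int in \<open>auto simp: euclidean_interior_of\<close>)
  then have "\<not> U \<subseteq> \<Union>((\<lambda>W. closure W - W) ` \<W>)"
    using U interior_maximal by (auto simp: euclidean_interior_of)
  then show thesis using that by blast
qed

lemma pointwise_BPB:
  fixes T :: "'x::banach \<Rightarrow> 'l::t2_space \<Rightarrow> real"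
  assumes sep: "separable_space (euclidean :: 'x topology)"
    and comp: "compact_space (euclidean :: 'l topology)"
    and ed: "extremally_disconnected (euclidean :: 'l topology)"
    and cont: "\<And>x. continuous_on UNIV (T x)" and lin: "\<And>t. linear (\<lambda>x. T x t)"
    and le: "\<And>x t. T x t \<le> norm x"
    and x0: "norm x0 = 1" "T x0 t1 > 1 - \<eta>" and e: "e > 0" and \<eta>: "\<eta> < e"
  obtains S u t0 where "\<And>x. continuous_on UNIV (S x)" "\<And>t. linear (\<lambda>x. S x t)"
    "\<And>x t. \<bar>S x t\<bar> \<le> norm x" "\<And>x t. \<bar>S x t - T x t\<bar> \<le> e * norm x"
    "norm u = 1" "norm (u - x0) \<le> 2 * \<eta> / e" "S u t0 = 1"
proof -
  note Tadd = linear_add[OF lin] and Tscale = linear_scale[OF lin]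
  have T0: "T 0 t = 0" and Tneg: "T (- x) t = - T x t" for x t
    using linear_0[OF lin] linear_neg[OF lin] by auto
  \<comment> \<open>The infimum over \<open>z\<close> is the infimal convolution of the norm with
    \<open>T z t + e * norm z\<close>. The choices \<open>z = 0\<close> and \<open>z = x\<close>
    show that it lies below both.\<close>
  define q where "q x z t = norm (x - z) + T z t + e * norm z" for x z :: 'x and t
  define P where "P x = cont_inf (range (q x))" for x
  have qcont: "continuous_on UNIV (q x z)" for x z
    unfolding q_def by (intro continuous_intros cont)
  have qlower: "- norm x \<le> q x z t" for x z t
  proof -
    have "- norm z \<le> T z t" using le[of "- z" t] by (simp add: Tneg)
    moreover have "norm z \<le> norm (x - z) + norm x"
      using norm_triangle_ineq[of "z - x" x] by (simp add: norm_minus_commute)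
    moreover have "0 \<le> e * norm z" using e by simp
    ultimately show ?thesis unfolding q_def by linarith
  qed
  have P: "sublinear_map P"
    unfolding P_def
  proof (rule sublinear_map_cont_inf[OF ed])
    fix x y f g assume "f \<in> range (q x)" "g \<in> range (q y)"
    then obtain z w where f: "f = q x z" and g: "g = q y w" by auto
    have "q (x + y) (z + w) t \<le> q x z t + q y w t" for t
    proof -
      have "norm (x + y - (z + w)) \<le> norm (x - z) + norm (y - w)"
        using norm_triangle_ineq[of "x - z" "y - w"] by (simp add: algebra_simps)
      moreover have "e * norm (z + w) \<le> e * norm z + e * norm w"
        using mult_left_mono[OF norm_triangle_ineq, of e z w] e by (simp add: distrib_left)
      ultimately show ?thesis unfolding q_def Tadd by linarith
    qed
    then show "\<exists>h\<in>range (q (x + y)). \<forall>t. h t \<le> f t + g t" by (auto simp: f g)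
  next
    fix x f and c :: real assume "f \<in> range (q x)" and c: "0 < c"
    then obtain z where f: "f = q x z" by auto
    have "norm (c *\<^sub>R x - c *\<^sub>R z) = c * norm (x - z)"
      using c by (simp flip: scaleR_diff_right)
    then have "q (c *\<^sub>R x) (c *\<^sub>R z) t = c * q x z t" for t
      using c by (simp add: q_def Tscale distrib_left)
    then show "\<exists>h\<in>range (q (c *\<^sub>R x)). \<forall>t. h t \<le> c * f t" by (auto simp: f intro!: exI[of _ "c *\<^sub>R z"])
  next
    fix x
    have "q x 0 t = norm x" for t by (simp add: q_def T0)
    then show "\<exists>f\<in>range (q x). \<forall>t. f t \<le> norm x" by (intro bexI[of _ "q x 0"]) auto
  qed (use qcont qlower in auto)
  have P_le: "P x t \<le> q x z t" for x z t
    unfolding P_def by (rule cont_inf_lower[where m = "- norm x"]) (use qcont qlower in auto)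

  obtain D :: "'x set" where D: "countable D" "closure D = UNIV"
    using sep by (auto simp: separable_space_def)
  \<comment> \<open>Restricting \<open>x\<close> to \<open>D\<close> and \<open>c\<close> to the
    rationals keeps this family countable.\<close>
  define W where "W x c = (\<Union>f\<in>range (q x). {s. f s < c})" for x c
  have W: "open (W x c)" for x c
    unfolding W_def by (intro open_UN ballI open_Collect_less continuous_intros) (use qcont in auto)
  obtain t0 where t0: "1 - \<eta> < T x0 t0"
    and gen: "\<And>x c. x \<in> D \<Longrightarrow> c \<in> \<rat> \<Longrightarrow> t0 \<in> closure (W x c) \<Longrightarrow> t0 \<in> W x c"
  proof (rule baire_generic_point[OF comp, of "(\<lambda>(x, c). W x c) ` (D \<times> \<rat>)" "{t. 1 - \<eta> < T x0 t}"])
    show "countable ((\<lambda>(x, c). W x c) ` (D \<times> \<rat>))"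
      using D(1) countable_rat by blast
    show "open {t. 1 - \<eta> < T x0 t}"
      by (intro open_Collect_less cont continuous_intros)
    show "{t. 1 - \<eta> < T x0 t} \<noteq> {}" using x0 by auto
    fix t assume t: "t \<in> {t. 1 - \<eta> < T x0 t}"
      and gen: "\<And>V. V \<in> (\<lambda>(x, c). W x c) ` (D \<times> \<rat>) \<Longrightarrow> t \<in> closure V \<Longrightarrow> t \<in> V"
    show thesis
    proof (rule that)
      show "1 - \<eta> < T x0 t" using t by simp
      show "t \<in> W x c" if "x \<in> D" "c \<in> \<rat>" "t \<in> closure (W x c)" for x c
        by (rule gen) (use that in auto)
    qed
  qed (use W in auto)
  obtain u where u: "norm u = 1" "norm (u - x0) \<le> 2 * \<eta> / e"
    and qu: "\<And>z. 1 \<le> norm (u - z) + T z t0 + e * norm z"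
    using norm_support_functional_perturbation[OF lin le x0(1) t0 e \<eta>] by blast

  \<comment> \<open>The point \<open>t0\<close> is generic only for vectors of \<open>D\<close>, and
    \<open>u\<close> depends on \<open>t0\<close>. So \<open>u\<close> is approximated by some
    \<open>y\<close> in \<open>D\<close>, at the cost of \<open>norm (y - u)\<close> once in
    \<open>q\<close> and once in \<open>P\<close>.\<close>
  have "1 - r \<le> P u t0" if "r > 0" for r
  proof -
    have "u \<in> closure D" by (simp add: D)
    then have "\<exists>y\<in>D. dist y u < r / 2"
      using \<open>r > 0\<close> unfolding closure_approachable by (meson half_gt_zero)
    then obtain y where y: "y \<in> D" "norm (y - u) < r / 2" by (auto simp: dist_norm)
    have "1 - norm (y - u) \<le> P y t0"
      unfolding P_def
    proof (rule cont_inf_greatest_pointwise[where m = "- norm y"])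
      fix f assume "f \<in> range (q y)"
      then obtain z where f: "f = q y z" by auto
      have "norm (u - z) \<le> norm (y - z) + norm (y - u)"
        using norm_triangle_ineq[of "u - y" "y - z"] by (simp add: norm_minus_commute)
      then show "1 - norm (y - u) \<le> f t0" using qu[of z] unfolding f q_def by linarith
    qed (use qcont qlower gen[OF y(1)] in \<open>auto simp: W_def\<close>)
    then show ?thesis using sublinear_map_diff[OF P, of y t0 u] y(2) by linarith
  qed
  then have "1 \<le> P u t0 + r" if "r > 0" for r using that by fastforce
  then have "1 \<le> P u t0" by (rule field_le_epsilon)
  then have Pu: "P u t0 = 1" using sublinear_map_norm[OF P, of u t0] u by simp
  obtain S where S: "\<And>x. continuous_on UNIV (S x)" "\<And>t. linear (\<lambda>x. S x t)"
    "\<And>x t. S x t \<le> P x t" "\<And>t. S u t = P u t"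
    using linear_minorant_of_sublinear_map[OF ed P sep, of u] by blast
  note Sneg = linear_neg[OF S(2)]
  have S1: "S x t \<le> norm x" for x t
    using S(3) sublinear_map_norm[OF P] by (rule order_trans)
  have S2: "S x t - T x t \<le> e * norm x" for x t
    using order_trans[OF S(3) P_le, of x t x] by (simp add: q_def)
  show thesis
  proof (rule that[OF S(1,2)])
    show "\<bar>S x t\<bar> \<le> norm x" for x t
      using S1[of x t] S1[of "- x" t] by (simp add: Sneg abs_le_iff)
    show "\<bar>S x t - T x t\<bar> \<le> e * norm x" for x t
      using S2[of x t] S2[of "- x" t] by (simp add: Sneg Tneg abs_le_iff)
    show "S u t0 = 1" by (simp add: S(4) Pu)
  qed (rule u)+
qed

section \<open>Transfer to operators into spaces of continuous functions\<close>

text \<open>This reduces both scalar fields to families of scalar functionals indexed by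
  \<open>L\<close>. The pointwise bound with \<open>\<epsilon> / 2\<close> leaves room for the
  strict inequality after the suprema are taken.\<close>

lemma BPBp_bcontfunI:
  fixes sX :: "'f::real_normed_field \<Rightarrow> 'x::banach \<Rightarrow> 'x"
  assumes comp: "compact_space (euclidean :: 'l::t2_space topology)" and sX: "normed_space_over sX"
    and step: "\<And>\<epsilon> (T :: 'x \<Rightarrow> 'l \<Rightarrow> 'f) x0 t1. \<lbrakk>0 < \<epsilon>; \<epsilon> < 1; \<And>x. continuous_on UNIV (T x);
      \<And>x y t. T (x + y) t = T x t + T y t; \<And>c x t. T (sX c x) t = c * T x t;
      \<And>x t. norm (T x t) \<le> norm x; norm x0 = 1; 1 - \<epsilon>\<^sup>2 / 8 < norm (T x0 t1)\<rbrakk> \<Longrightarrow>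
      \<exists>S u t0. (\<forall>x. continuous_on UNIV (S x)) \<and> (\<forall>x y t. S (x + y) t = S x t + S y t) \<and>
        (\<forall>c x t. S (sX c x) t = c * S x t) \<and> (\<forall>x t. norm (S x t) \<le> norm x) \<and>
        (\<forall>x t. norm (S x t - T x t) \<le> \<epsilon> / 2 * norm x) \<and>
        norm u = 1 \<and> norm (u - x0) < \<epsilon> \<and> norm (S u t0) = 1"
  shows "BPBp sX (scale_bcontfun :: 'f \<Rightarrow> ('l \<Rightarrow>\<^sub>C 'f) \<Rightarrow> ('l \<Rightarrow>\<^sub>C 'f))"
  unfolding BPBp_def
proof (intro allI impI, elim conjE)
  fix \<epsilon> :: real assume \<epsilon>: "0 < \<epsilon>" "\<epsilon> < 1"
  interpret X: normed_space_over sX by fact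
  interpret Y: normed_space_over "scale_bcontfun :: 'f \<Rightarrow> ('l \<Rightarrow>\<^sub>C 'f) \<Rightarrow> ('l \<Rightarrow>\<^sub>C 'f)"
    by (rule normed_space_over_scale_bcontfun)
  show "\<exists>\<eta>>0. \<forall>T \<in> bounded_operators sX (scale_bcontfun :: 'f \<Rightarrow> ('l \<Rightarrow>\<^sub>C 'f) \<Rightarrow> _). \<forall>x0.
      norm T = 1 \<and> norm x0 = 1 \<and> norm (blinfun_apply T x0) > 1 - \<eta> \<longrightarrow>
      (\<exists>S \<in> bounded_operators sX scale_bcontfun. \<exists>u0. norm S = 1 \<and> norm u0 = 1 \<and>
        norm (blinfun_apply S u0) = 1 \<and> norm (u0 - x0) < \<epsilon> \<and> norm (S - T) < \<epsilon>)"
  proof (intro exI[of _ "\<epsilon>\<^sup>2 / 8"] conjI ballI allI impI; (elim conjE)?)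
    show "0 < \<epsilon>\<^sup>2 / 8" using \<epsilon> by simp
    fix T :: "'x \<Rightarrow>\<^sub>L ('l \<Rightarrow>\<^sub>C 'f)" and x0
    assume T: "T \<in> bounded_operators sX scale_bcontfun" "norm T = 1" and x0: "norm x0 = 1"
      and Tx0: "1 - \<epsilon>\<^sup>2 / 8 < norm (blinfun_apply T x0)"
    interpret T: Vector_Spaces.linear sX scale_bcontfun "blinfun_apply T"
      using T(1) by (simp add: bounded_operators_def)
    have "norm (blinfun_apply T x) \<le> norm x" for x
      using norm_blinfun[of T x] T(2) by simp
    then have Tle: "norm (blinfun_apply T x t) \<le> norm x" for x t
      using norm_bounded order_trans by blast
    obtain t1 where t1: "1 - \<epsilon>\<^sup>2 / 8 < norm (blinfun_apply T x0 t1)"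
      using norm_bound[of "blinfun_apply T x0" "1 - \<epsilon>\<^sup>2 / 8"] Tx0 by (meson not_le)
    obtain S u t0 where Scont: "\<And>x. continuous_on UNIV (S x)"
      and Sadd: "\<And>x y t. S (x + y) t = S x t + S y t"
      and Sscale: "\<And>c x t. S (sX c x) t = c * S x t" and Sle: "\<And>x t. norm (S x t) \<le> norm x"
      and ST: "\<And>x t. norm (S x t - blinfun_apply T x t) \<le> \<epsilon> / 2 * norm x"
      and u: "norm u = 1" "norm (u - x0) < \<epsilon>" "norm (S u t0) = 1"
      using step[of \<epsilon> "\<lambda>x. apply_bcontfun (blinfun_apply T x)" x0 t1] \<epsilon> Tle x0 t1
      by (auto simp: T.add T.scale)
    define A where "A x = Bcontfun (S x)" for x
    have A: "apply_bcontfun (A x) = S x" for x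
      unfolding A_def using Scont Sle by (intro Bcontfun_inverse bcontfun_normI) auto
    have Aadd: "A (x + y) = A x + A y" for x y
      by (rule bcontfun_eqI) (simp add: A Sadd)
    have Ascale: "A (sX c x) = scale_bcontfun c (A x)" for c x
      by (rule bcontfun_eqI) (simp add: A Sscale)
    have Ale: "norm (A x) \<le> norm x" for x by (rule norm_bound) (simp add: A Sle)
    have "bounded_linear A"
    proof (rule bounded_linear_intro[where K = 1])
      show "A (r *\<^sub>R x) = r *\<^sub>R A x" for r x
        using Ascale[of "of_real r" x] by (simp add: X.scale_of_real Y.scale_of_real)
    qed (simp_all add: Aadd Ale)
    then have B: "blinfun_apply (Blinfun A) = A" by (rule bounded_linear_Blinfun_apply)
    have "Vector_Spaces.linear sX scale_bcontfun A"
      by unfold_locales (simp_all add: Aadd Ascale)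
    then have BO: "Blinfun A \<in> bounded_operators sX scale_bcontfun"
      by (simp add: bounded_operators_def B)
    have Au: "norm (A u) = 1"
      using Ale[of u] norm_bounded[of "A u" t0] u by (simp add: A)
    have "norm (Blinfun A) \<le> 1" by (rule norm_blinfun_bound) (simp_all add: B Ale)
    moreover have "1 \<le> norm (Blinfun A)" using norm_blinfun[of "Blinfun A" u] by (simp add: B Au u)
    ultimately have nB: "norm (Blinfun A) = 1" by simp
    have "norm (blinfun_apply (Blinfun A - T) x) \<le> \<epsilon> / 2 * norm x" for x
      by (rule norm_bound) (simp add: blinfun.diff_left B A ST del: times_divide_eq_left)
    then have "norm (Blinfun A - T) \<le> \<epsilon> / 2" using \<epsilon> by (intro norm_blinfun_bound) auto
    then have "norm (Blinfun A - T) < \<epsilon>" using \<epsilon> by simp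
    with BO nB Au u show "\<exists>S \<in> bounded_operators sX scale_bcontfun. \<exists>u0. norm S = 1 \<and> norm u0 = 1 \<and>
        norm (blinfun_apply S u0) = 1 \<and> norm (u0 - x0) < \<epsilon> \<and> norm (S - T) < \<epsilon>"
      by (intro bexI[of _ "Blinfun A"] exI[of _ u]) (simp_all add: B)
  qed
qed

text \<open>With \<open>\<eta> = \<epsilon>\<^sup>2 / 8\<close> and
  \<open>e = \<epsilon> / 2\<close>, these are the condition \<open>\<eta> < e\<close> of
  \<open>pointwise_BPB\<close> and the smallness of its bound on
  \<open>norm (u - x0)\<close>.\<close>

lemma BPB_constants:
  fixes \<epsilon> :: real assumes "0 < \<epsilon>" "\<epsilon> < 1"
  shows "\<epsilon>\<^sup>2 / 8 < \<epsilon> / 2" "2 * (\<epsilon>\<^sup>2 / 8) / (\<epsilon> / 2) < \<epsilon>"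
proof -
  have "\<epsilon>\<^sup>2 < \<epsilon> * 1" unfolding power2_eq_square using assms by (intro mult_strict_left_mono)
  then show "\<epsilon>\<^sup>2 / 8 < \<epsilon> / 2" using assms by simp
  show "2 * (\<epsilon>\<^sup>2 / 8) / (\<epsilon> / 2) < \<epsilon>" using assms by (simp add: power2_eq_square)
qed

lemma BPBp_real:
  assumes sep: "separable_space (euclidean :: 'x::banach topology)"
    and comp: "compact_space (euclidean :: 'l::t2_space topology)"
    and ed: "extremally_disconnected (euclidean :: 'l topology)"
  shows "BPBp (scaleR :: real \<Rightarrow> 'x \<Rightarrow> 'x)
              (scale_bcontfun :: real \<Rightarrow> ('l \<Rightarrow>\<^sub>C real) \<Rightarrow> ('l \<Rightarrow>\<^sub>C real))"
proof (rule BPBp_bcontfunI[OF comp normed_space_over_scaleR])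
  fix \<epsilon> :: real and T :: "'x \<Rightarrow> 'l \<Rightarrow> real" and x0 t1
  assume \<epsilon>: "0 < \<epsilon>" "\<epsilon> < 1" and cont: "\<And>x. continuous_on UNIV (T x)"
    and add: "\<And>x y t. T (x + y) t = T x t + T y t" and scale: "\<And>c x t. T (c *\<^sub>R x) t = c * T x t"
    and le: "\<And>x t. norm (T x t) \<le> norm x" and x0: "norm x0 = 1" "1 - \<epsilon>\<^sup>2 / 8 < norm (T x0 t1)"
  \<comment> \<open>The sign makes the value at \<open>t1\<close> positive, as
    \<open>pointwise_BPB\<close> requires; multiplying \<open>u\<close> by it again returns to
    \<open>x0\<close>.\<close>
  define \<theta> where "\<theta> = (if 0 \<le> T x0 t1 then 1 else - 1 :: real)"
  have \<theta>: "\<theta> * \<theta> = 1" "\<bar>\<theta>\<bar> = 1" "\<theta> * T x0 t1 = norm (T x0 t1)" by (auto simp: \<theta>_def)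
  have lin: "linear (\<lambda>x. T x t)" for t by (rule linearI) (simp_all add: add scale)
  have leT: "T x t \<le> norm x" for x t using le[of x t] by simp
  have x1: "norm (\<theta> *\<^sub>R x0) = 1" "1 - \<epsilon>\<^sup>2 / 8 < T (\<theta> *\<^sub>R x0) t1"
    using x0 by (simp_all add: \<theta> scale del: real_norm_def)
  have \<epsilon>2: "0 < \<epsilon> / 2" using \<epsilon> by simp
  obtain S u t0 where S: "\<And>x. continuous_on UNIV (S x)" "\<And>t. linear (\<lambda>x. S x t)"
    "\<And>x t. \<bar>S x t\<bar> \<le> norm x" "\<And>x t. \<bar>S x t - T x t\<bar> \<le> \<epsilon> / 2 * norm x"
    and u: "norm u = 1" "norm (u - \<theta> *\<^sub>R x0) \<le> 2 * (\<epsilon>\<^sup>2 / 8) / (\<epsilon> / 2)" "S u t0 = 1"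
    by (rule pointwise_BPB[OF sep comp ed cont lin leT x1 \<epsilon>2 BPB_constants(1)[OF \<epsilon>]]) (rule that)
  have "\<theta> *\<^sub>R u - x0 = \<theta> *\<^sub>R (u - \<theta> *\<^sub>R x0)" by (simp add: scaleR_diff_right \<theta>)
  then have "norm (\<theta> *\<^sub>R u - x0) = norm (u - \<theta> *\<^sub>R x0)" by (simp add: \<theta>)
  also have "\<dots> < \<epsilon>" using u(2) BPB_constants(2)[OF \<epsilon>] by simp
  finally have "norm (\<theta> *\<^sub>R u - x0) < \<epsilon>" .
  then show "\<exists>S u t0. (\<forall>x. continuous_on UNIV (S x)) \<and> (\<forall>x y t. S (x + y) t = S x t + S y t) \<and>
        (\<forall>c x t. S (c *\<^sub>R x) t = c * S x t) \<and> (\<forall>x t. norm (S x t) \<le> norm x) \<and>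
        (\<forall>x t. norm (S x t - T x t) \<le> \<epsilon> / 2 * norm x) \<and>
        norm u = 1 \<and> norm (u - x0) < \<epsilon> \<and> norm (S u t0) = 1"
    using S(1,3,4) u \<theta> linear_add[OF S(2)] linear_scale[OF S(2)]
    by (intro exI[of _ S] exI[of _ "\<theta> *\<^sub>R u"] exI[of _ t0]) auto
qed

text \<open>Rotating \<open>x\<close> makes \<open>f x\<close> equal to its real part.\<close>

lemma norm_le_of_Re_le:
  fixes sX :: "complex \<Rightarrow> 'x::real_normed_vector \<Rightarrow> 'x" and f :: "'x \<Rightarrow> complex"
  assumes sX: "normed_space_over sX" and scale: "\<And>c x. f (sX c x) = c * f x"
    and le: "\<And>x. Re (f x) \<le> C * norm x"
  shows "norm (f x) \<le> C * norm x"
proof (cases "f x = 0")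
  case True
  then show ?thesis using le[of x] by simp
next
  case False
  interpret normed_space_over sX by fact
  define \<theta> where "\<theta> = cnj (sgn (f x))"
  have "norm \<theta> = 1" using False by (simp add: \<theta>_def norm_sgn)
  moreover have "\<theta> * f x = of_real (norm (f x))"
    using False by (simp add: \<theta>_def sgn_eq complex_norm_square[symmetric] power2_eq_square mult.commute)
  ultimately show ?thesis using le[of "sX \<theta> x"] by (simp add: scale norm_scale)
qed

text \<open>The real result is applied to \<open>Re (T x t)\<close> after rotating
  \<open>x0\<close>. A complex linear map is determined by its real part, and
  \<open>norm_le_of_Re_le\<close> turns the bounds on real parts into bounds on moduli.\<close>

lemma BPBp_complex:
  fixes sX :: "complex \<Rightarrow> 'x::banach \<Rightarrow> 'x"
  assumes sep: "separable_space (euclidean :: 'x topology)"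
    and comp: "compact_space (euclidean :: 'l::t2_space topology)"
    and ed: "extremally_disconnected (euclidean :: 'l topology)"
    and sX: "normed_space_over sX"
  shows "BPBp sX (scale_bcontfun :: complex \<Rightarrow> ('l \<Rightarrow>\<^sub>C complex) \<Rightarrow> ('l \<Rightarrow>\<^sub>C complex))"
proof (rule BPBp_bcontfunI[OF comp sX])
  interpret X: normed_space_over sX by fact
  fix \<epsilon> :: real and T :: "'x \<Rightarrow> 'l \<Rightarrow> complex" and x0 t1
  assume \<epsilon>: "0 < \<epsilon>" "\<epsilon> < 1" and cont: "\<And>x. continuous_on UNIV (T x)"
    and add: "\<And>x y t. T (x + y) t = T x t + T y t" and scale: "\<And>c x t. T (sX c x) t = c * T x t"
    and le: "\<And>x t. norm (T x t) \<le> norm x" and x0: "norm x0 = 1" "1 - \<epsilon>\<^sup>2 / 8 < norm (T x0 t1)"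
  have "\<epsilon>\<^sup>2 < 1" using \<epsilon> by (simp add: power_less_one_iff)
  then have nz: "T x0 t1 \<noteq> 0" using x0 by auto
  define \<theta> where "\<theta> = cnj (sgn (T x0 t1))"
  have "norm \<theta> = 1" using nz by (simp add: \<theta>_def norm_sgn)
  moreover have "\<theta> * T x0 t1 = of_real (norm (T x0 t1))"
    using nz by (simp add: \<theta>_def sgn_eq complex_norm_square[symmetric] power2_eq_square mult.commute)
  ultimately have \<theta>: "norm \<theta> = 1" "\<theta> * T x0 t1 = of_real (norm (T x0 t1))" by simp_all
  then have \<theta>0: "\<theta> \<noteq> 0" by auto
  have scaleR: "T (r *\<^sub>R x) t = of_real r * T x t" for r x t
    using scale[of "of_real r" x t] by (simp add: X.scale_of_real)
  have contR: "continuous_on UNIV (\<lambda>t. Re (T x t))" for x by (intro continuous_intros cont)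
  have lin: "linear (\<lambda>x. Re (T x t))" for t by (rule linearI) (simp_all add: add scaleR)
  have leT: "Re (T x t) \<le> norm x" for x t using le[of x t] complex_Re_le_cmod order_trans by blast
  have x1: "norm (sX \<theta> x0) = 1" "1 - \<epsilon>\<^sup>2 / 8 < Re (T (sX \<theta> x0) t1)"
    using x0 by (simp_all add: \<theta> scale X.norm_scale)
  have \<epsilon>2: "0 < \<epsilon> / 2" using \<epsilon> by simp
  obtain R u t0 where R: "\<And>x. continuous_on UNIV (R x)" "\<And>t. linear (\<lambda>x. R x t)"
    "\<And>x t. \<bar>R x t\<bar> \<le> norm x" "\<And>x t. \<bar>R x t - Re (T x t)\<bar> \<le> \<epsilon> / 2 * norm x"
    and u: "norm u = 1" "norm (u - sX \<theta> x0) \<le> 2 * (\<epsilon>\<^sup>2 / 8) / (\<epsilon> / 2)" "R u t0 = 1"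
    by (rule pointwise_BPB[OF sep comp ed contR lin leT x1 \<epsilon>2 BPB_constants(1)[OF \<epsilon>]]) (rule that)
  note Radd = linear_add[OF R(2)] and Rscale = linear_scale[OF R(2)]
  \<comment> \<open>The only possible complex linear map with real part \<open>R\<close>, since
    \<open>Im (S x t)\<close> must equal \<open>- Re (S (sX \<i> x) t)\<close>.\<close>
  define S where "S x t = Complex (R x t) (- R (sX \<i> x) t)" for x t
  have ReS: "Re (S x t) = R x t" for x t by (simp add: S_def)
  have Scont: "continuous_on UNIV (S x)" for x
    unfolding S_def Complex_eq by (intro continuous_intros R(1))
  have Sadd: "S (x + y) t = S x t + S y t" for x y t
    by (simp add: S_def complex_eq_iff X.scale_right_distrib Radd)
  have Rc: "R (sX c x) t = Re c * R x t + Im c * R (sX \<i> x) t" for c x t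
  proof -
    have "sX c x = sX (of_real (Re c) + of_real (Im c) * \<i>) x"
      by (simp add: complex_eq mult.commute)
    also have "\<dots> = Re c *\<^sub>R x + Im c *\<^sub>R sX \<i> x"
      by (simp only: X.scale_left_distrib X.scale_of_real flip: X.scale_scale)
    finally show ?thesis by (simp add: Radd Rscale)
  qed
  have Sscale: "S (sX c x) t = c * S x t" for c x t
    using Rc[of c x t] Rc[of "\<i> * c" x t] by (simp add: S_def complex_eq_iff algebra_simps)
  have Sle: "norm (S x t) \<le> norm x" for x t
  proof -
    have "Re (S y t) \<le> 1 * norm y" for y using R(3)[of y t] by (simp add: ReS)
    from norm_le_of_Re_le[OF sX Sscale this] show ?thesis by simp
  qed
  have ST: "norm (S x t - T x t) \<le> \<epsilon> / 2 * norm x" for x t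
  proof (rule norm_le_of_Re_le[OF sX, of "\<lambda>x. S x t - T x t"])
    show "Re (S y t - T y t) \<le> \<epsilon> / 2 * norm y" for y
      using R(4)[of y t] by (simp only: minus_complex.simps ReS abs_le_iff)
  qed (simp add: Sscale scale right_diff_distrib)
  \<comment> \<open>This undoes the rotation by \<open>\<theta>\<close>; as
    \<open>norm \<theta> = 1\<close>, norms and distances are unchanged.\<close>
  define v where "v = sX (inverse \<theta>) u"
  have nv: "norm v = 1" by (simp add: v_def X.norm_scale norm_inverse \<theta> u)
  have "v - x0 = sX (inverse \<theta>) (u - sX \<theta> x0)"
    by (simp add: v_def X.scale_right_diff_distrib \<theta>0)
  then have "norm (v - x0) = norm (u - sX \<theta> x0)" by (simp add: X.norm_scale norm_inverse \<theta>)
  also have "\<dots> < \<epsilon>" using u(2) BPB_constants(2)[OF \<epsilon>] by simp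
  finally have vx: "norm (v - x0) < \<epsilon>" .
  have "1 \<le> norm (S u t0)" using complex_Re_le_cmod[of "S u t0"] by (simp add: ReS u)
  then have "norm (S u t0) = 1" using Sle[of u t0] u(1) by simp
  then have "norm (S v t0) = 1" by (simp add: v_def Sscale norm_mult norm_inverse \<theta>)
  with Scont Sadd Sscale Sle ST nv vx
  show "\<exists>S u t0. (\<forall>x. continuous_on UNIV (S x)) \<and> (\<forall>x y t. S (x + y) t = S x t + S y t) \<and>
        (\<forall>c x t. S (sX c x) t = c * S x t) \<and> (\<forall>x t. norm (S x t) \<le> norm x) \<and>
        (\<forall>x t. norm (S x t - T x t) \<le> \<epsilon> / 2 * norm x) \<and>
        norm u = 1 \<and> norm (u - x0) < \<epsilon> \<and> norm (S u t0) = 1"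
    by (intro exI[of _ S] exI[of _ v] exI[of _ t0]) blast
qed

theorem theorem1:
  assumes "separable_space (euclidean :: 'x::banach topology)"
    and "compact_space (euclidean :: 'l::t2_space topology)"
    and "extremally_disconnected (euclidean :: 'l topology)"
  shows "BPBp (scaleR :: real \<Rightarrow> 'x \<Rightarrow> 'x)
              (scale_bcontfun :: real \<Rightarrow> ('l \<Rightarrow>\<^sub>C real) \<Rightarrow> ('l \<Rightarrow>\<^sub>C real)) \<and>
         (\<forall>sX :: complex \<Rightarrow> 'x \<Rightarrow> 'x. normed_space_over sX \<longrightarrow>
            BPBp sX (scale_bcontfun :: complex \<Rightarrow> ('l \<Rightarrow>\<^sub>C complex) \<Rightarrow> ('l \<Rightarrow>\<^sub>C complex)))"
  using BPBp_real BPBp_complex assms by blast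

end
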